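(* Let $d,k,\ell\ge 1$ be integers. There is a constant $A=A(d,k,\ell)>0$, depending only on $d,k,\ell$, such that the following holds. For every $m=(m_1,\dots,m_d)\in\mathbb{Z}_+^d$ (positive integers) with $m_i/m_j\le \ell$ for all $i,j=1,\dots,d$, and every function $f:\Gamma_m\to\mathbb{R}$ on the lattice $\Gamma_m\subset\mathbb{T}^d$, there is a function $F:\mathbb{T}^d\to\mathbb{R}$ of class $C^{k-1}$ such that $F(x)=f(x)$ for all $x\in\Gamma_m$ and $$\mathrm{Lip}(D^{k-1}F)\le A\,|||\Delta^k f|||_{\Gamma_m}.$$
   Context: $\mathbb{T}^d=\mathbb{R}^d/\mathbb{Z}^d$. For $m\in\mathbb{Z}_+^d$ put $\tilde\Gamma=m_1^{-1}\mathbb{Z}\times\cdots\times m_d^{-1}\mathbb{Z}\subset\mathbb{R}^d$ and $\Gamma_m=\tilde\Gamma/\mathbb{Z}^d\subset\mathbb{T}^d$. Functions on $\Gamma_m$ (resp. $\mathbb{T}^d$) are identified with $\mathbb{Z}^d$-periodic functions on $\tilde\Gamma$ (resp. $\mathbb{R}^d$). The space $\mathbb{R}^d$ carries the sum-norm $\|x\|=\sum_{i=1}^d|x_i|$. For a vector $v$, $\Delta_v f(x)=f(x+v)-f(x)$; for $u=(u_1,\dots,u_k)\in\tilde\Gamma^k$, $\Delta^k_u=\Delta_{u_1}\circ\cdots\circ\Delta_{u_k}$ and $\|u\|^k:=\|u_1\|\cdots\|u_k\|$ (a product of norms). With $f$ regarded as a periodic function on $\tilde\Gamma$, $$|||\Delta^k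 f|||_{\Gamma_m}=\sup_{u\in(\tilde\Gamma\setminus\{0\})^k}\ \sup_{x\in\tilde\Gamma}\frac{|\Delta^k_u f(x)|}{\|u\|^k}.$$ $D^{k-1}F$ is the $(k-1)$-th derivative of the lift $F:\mathbb{R}^d\to\mathbb{R}$ (with $D^0F=F$), with values in the symmetric $(k-1)$-multilinear maps $\xi$ on $\mathbb{R}^d$, normed by $\|\xi\|=\sup |\xi(u_1,\dots,u_{k-1})|/(\|u_1\|\cdots\|u_{k-1}\|)$ over nonzero vectors $u_i$. $\mathrm{Lip}(\cdot)$ denotes the (least) Lipschitz constant, understood to be $+\infty$ if the map is not Lipschitz. *)

theory Defs
  imports "HOL-Analysis.Analysis"
begin

definition sum_norm :: "real^'d \<Rightarrow> real" where
  "sum_norm x = (\<Sum>i\<in>UNIV. \<bar>x $ i\<bar>)"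

definition integer_lattice :: "(real^'d) set" where
  "integer_lattice = {z. \<forall>i. z $ i \<in> \<int>}"

(* The full preimage in R^d of the finite lattice in the torus,
   i.e. the product of the groups (1 / m_i) Z. *)
definition refined_lattice :: "nat^'d \<Rightarrow> (real^'d) set" where
  "refined_lattice m = {x. \<forall>i. \<exists>z::int. x $ i = of_int z / real (m $ i)}"

(* A function on the quotient of S by Z^d is represented by a periodic function on S,
   itself given as a total function whose values outside S are irrelevant. *)
definition periodic_on :: "(real^'d) set \<Rightarrow> (real^'d \<Rightarrow> real) \<Rightarrow> bool" where
  "periodic_on S f \<longleftrightarrow> (\<forall>x\<in>S. \<forall>z\<in>integer_lattice. f (x + z) = f x)"

definition forward_diff :: "real^'d \<Rightarrow> (real^'d \<Rightarrow> real) \<Rightarrow> real^'d \<Rightarrow> real" where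
  "forward_diff v f = (\<lambda>x. f (x + v) - f x)"

(* Tuples of vectors are lists; [u_1, ..., u_k] yields the composition of the
   differences along u_1, ..., u_k. *)
definition iter_diff :: "(real^'d) list \<Rightarrow> (real^'d \<Rightarrow> real) \<Rightarrow> real^'d \<Rightarrow> real" where
  "iter_diff us f = foldr forward_diff us f"

definition tuple_norm :: "(real^'d) list \<Rightarrow> real" where
  "tuple_norm us = prod_list (map sum_norm us)"

definition diff_seminorm :: "nat \<Rightarrow> nat^'d \<Rightarrow> (real^'d \<Rightarrow> real) \<Rightarrow> ennreal" where
  "diff_seminorm k m f =
     (SUP us \<in> {us. length us = k \<and> set us \<subseteq> refined_lattice m - {0}}.
        SUP x \<in> refined_lattice m. ennreal (\<bar>iter_diff us f x\<bar> / tuple_norm us))"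

(* iter_deriv F x [u_1, ..., u_n] is the n-th Frechet derivative of F at x, evaluated on
   (u_1, ..., u_n).  The order n is the length of the list; an n-multilinear form is
   represented by a function on lists of which only the lists of length n matter. *)
fun iter_deriv :: "(real^'d \<Rightarrow> real) \<Rightarrow> real^'d \<Rightarrow> (real^'d) list \<Rightarrow> real" where
  "iter_deriv F x [] = F x"
| "iter_deriv F x (u # us) = frechet_derivative (\<lambda>y. iter_deriv F y us) (at x) u"

(* Differentiability and continuity of the form-valued derivatives are expressed through
   their evaluations; the space of n-multilinear forms on R^d being finite-dimensional,
   this is the same as with respect to the norm of forms. *)
definition class_C :: "nat \<Rightarrow> (real^'d \<Rightarrow> real) \<Rightarrow> bool" where
  "class_C n F \<longleftrightarrow>
     (\<forall>us x. length us < n \<longrightarrow> (\<lambda>y. iter_deriv F y us) differentiable (at x)) \<and>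
     (\<forall>us. length us = n \<longrightarrow> continuous_on UNIV (\<lambda>y. iter_deriv F y us))"

definition form_norm :: "nat \<Rightarrow> ((real^'d) list \<Rightarrow> real) \<Rightarrow> ennreal" where
  "form_norm n \<xi> =
     (SUP us \<in> {us. length us = n \<and> 0 \<notin> set us}. ennreal (\<bar>\<xi> us\<bar> / tuple_norm us))"

(* The least Lipschitz constant of a map into n-multilinear forms.  The value top always
   belongs to the set, and it is the only element when the map is not Lipschitz. *)
definition Lip :: "nat \<Rightarrow> (real^'d \<Rightarrow> (real^'d) list \<Rightarrow> real) \<Rightarrow> ennreal" where
  "Lip n G =
     Inf {L. \<forall>x y. form_norm n (\<lambda>us. G x us - G y us) \<le> L * ennreal (sum_norm (x - y))}"

end

theory Submission
  imports Defs "HOL-Computational_Algebra.Polynomial"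
begin

text \<open>
  The function \<open>F\<close> is a tensor product of one-dimensional interpolating splines. The point of the
  construction is that in one dimension every derivative of order \<open>b \<le> k\<close> of the spline is a local
  combination, with bounded weights, of the \<open>b\<close>-th differences of the data (\<open>spline_local_combination\<close>). Taking tensor
  products, the mixed partial derivative of \<open>F\<close> in the coordinate directions \<open>i\<^sub>1, \<dots>, i\<^sub>k\<close> is
  \<open>m i\<^sub>1 \<cdots> m i\<^sub>k\<close> times a bounded combination of differences of \<open>f\<close> along the lattice vectors
  \<open>e i\<^sub>1 / m i\<^sub>1, \<dots>, e i\<^sub>k / m i\<^sub>k\<close>. The lengths of these vectors cancel the scaling factors
  exactly, so all partial derivatives of order \<open>k\<close> are at most a constant times the seminorm of \<open>f\<close>
  (\<open>tensor_spline_bound\<close>). The sum-norm is adapted to expanding a multilinear form in coordinates,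
  and the mean value theorem turns the bound into the Lipschitz bound for the derivative of order
  \<open>k - 1\<close>.

  The one-dimensional spline comes from Newton interpolation. Let \<open>P n\<close> be the polynomial of degree
  less than \<open>k\<close> that agrees with the data \<open>g\<close> at \<open>n, \<dots>, n + k - 1\<close>. On \<open>[n, n + 1]\<close> the spline is
  \<open>(1 - \<theta>) P n + \<theta> P (n + 1)\<close>, where \<open>\<theta>\<close> is a polynomial that passes from 0 to 1 and is flat to
  order \<open>k\<close> at both ends; this makes the pieces fit together \<open>k\<close> times differentiably. Since
  \<open>P (n + 1) - P n\<close> is a multiple of the \<open>k\<close>-th difference of \<open>g\<close> at \<open>n\<close>, the spline on this interval
  is a combination of the differences of orders \<open>0, \<dots>, k\<close> at \<open>n\<close>, in which the difference of order
  \<open>a < k\<close> multiplies a polynomial of degree \<open>a\<close>. Differentiating \<open>b\<close> times kills all differences of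
  order less than \<open>b\<close>, and the others are combinations of \<open>b\<close>-th differences.

  Periodicity is built in by applying the spline to the indicators of the residue classes modulo
  \<open>m i\<close>, so that \<open>F\<close> is a finite sum over one period of the lattice.
\<close>

section \<open>Gluing polynomial pieces\<close>

lemma higher_pderiv_shift:
  "(pderiv ^^ b) (pcompose p [:c, 1:]) = pcompose ((pderiv ^^ b) p) [:c, 1 :: real:]"
  by (induction b arbitrary: p) (simp_all add: pderiv_pcompose pderiv_pCons)

lemma higher_pderiv_root:
  fixes p :: "real poly"
  assumes "[:0, 1:] ^ Suc k dvd p" "b \<le> k"
  shows "poly ((pderiv ^^ b) p) 0 = 0"
proof -
  have "[:0, 1:] ^ Suc (k - b) dvd (pderiv ^^ b) p"
    using \<open>b \<le> k\<close>
  proof (induction b)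
    case 0
    then show ?case using assms by simp
  next
    case (Suc b)
    define r where "r = k - Suc b"
    have "[:0, 1:] ^ Suc (Suc r) dvd (pderiv ^^ b) p"
      using Suc by (simp add: r_def Suc_diff_Suc del: power_Suc)
    then obtain q where q: "(pderiv ^^ b) p = [:0, 1:] ^ Suc (Suc r) * q"
      by (elim dvdE)
    have "pderiv ([:0, 1:] ^ Suc (Suc r) * q)
        = [:0, 1:] ^ Suc r * (smult (of_nat (Suc (Suc r))) q + [:0, 1:] * pderiv q)"
      unfolding pderiv_mult pderiv_power_Suc
      by (simp add: pderiv_pCons algebra_simps del: of_nat_Suc)
    then show ?case
      by (simp add: q r_def del: power_Suc)
  qed
  then have "[:0, 1:] dvd (pderiv ^^ b) p"
    by (rule dvd_trans[rotated]) (simp only: power_Suc dvd_triv_left)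
  then show ?thesis
    by (auto elim!: dvdE)
qed

text \<open>
  A function given by a polynomial on each interval between integers is differentiable everywhere
  as soon as values and first derivatives agree at the integers. Applied to successive derivatives
  of the pieces, this yields all the smoothness of the splines.
\<close>

lemma has_derivative_floor_glued_polys:
  fixes p :: "int \<Rightarrow> real poly"
  assumes "\<And>n. poly (p n) 1 = poly (p (n + 1)) 0"
    and "\<And>n. poly (pderiv (p n)) 1 = poly (pderiv (p (n + 1))) 0"
  shows "((\<lambda>t. poly (p \<lfloor>t\<rfloor>) (frac t)) has_real_derivative
           poly (pderiv (p \<lfloor>t\<rfloor>)) (frac t)) (at t)"
proof -
  define f where "f = (\<lambda>t. poly (p \<lfloor>t\<rfloor>) (frac t))"
  have local: "((\<lambda>x. poly (p n) (x - of_int n)) has_real_derivative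
      poly (pderiv (p n)) (t - of_int n)) (at t within S)" for n S
    by (auto intro!: derivative_eq_intros)
  have right: "(f has_real_derivative poly (pderiv (p \<lfloor>t\<rfloor>)) (frac t)) (at t within {t..})"
  proof (rule has_field_derivative_transform_within)
    show "((\<lambda>x. poly (p \<lfloor>t\<rfloor>) (x - of_int \<lfloor>t\<rfloor>)) has_real_derivative
        poly (pderiv (p \<lfloor>t\<rfloor>)) (frac t)) (at t within {t..})"
      using local[of "\<lfloor>t\<rfloor>"] by (simp add: frac_def)
    show "0 < of_int \<lfloor>t\<rfloor> + 1 - t" by linarith
    fix x assume x: "x \<in> {t..}" "dist x t < of_int \<lfloor>t\<rfloor> + 1 - t"
    then have "\<lfloor>x\<rfloor> = \<lfloor>t\<rfloor>"
      by (auto simp: floor_eq_iff dist_real_def) linarith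
    then show "poly (p \<lfloor>t\<rfloor>) (x - of_int \<lfloor>t\<rfloor>) = f x"
      by (simp add: f_def frac_def)
  qed simp
  \<comment> \<open>The piece on the left of \<open>t\<close>; it differs from the piece of \<open>\<lfloor>t\<rfloor>\<close> when \<open>t\<close> is an integer.\<close>
  define n where "n = \<lceil>t\<rceil> - 1"
  have n: "of_int n < t" "t \<le> of_int n + 1"
    unfolding n_def by linarith+
  have eq: "poly (p \<lfloor>x\<rfloor>) (frac x) = poly (p n) (x - of_int n)"
       "poly (pderiv (p \<lfloor>x\<rfloor>)) (frac x) = poly (pderiv (p n)) (x - of_int n)"
    if "of_int n \<le> x" "x \<le> of_int n + 1" for x
  proof -
    have "\<lfloor>x\<rfloor> = n \<or> x = of_int (n + 1)"
      using that by (simp add: floor_eq_iff) linarith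
    then show "poly (p \<lfloor>x\<rfloor>) (frac x) = poly (p n) (x - of_int n)"
       "poly (pderiv (p \<lfloor>x\<rfloor>)) (frac x) = poly (pderiv (p n)) (x - of_int n)"
      using assms[of n] by (auto simp: frac_def)
  qed
  have left: "(f has_real_derivative poly (pderiv (p \<lfloor>t\<rfloor>)) (frac t)) (at t within {..t})"
  proof (rule has_field_derivative_transform_within)
    show "((\<lambda>x. poly (p n) (x - of_int n)) has_real_derivative
        poly (pderiv (p \<lfloor>t\<rfloor>)) (frac t)) (at t within {..t})"
      using local[of n] eq(2)[of t] n by simp
    show "0 < t - of_int n" using n by simp
    fix x assume "x \<in> {..t}" "dist x t < t - of_int n"
    then show "poly (p n) (x - of_int n) = f x"
      using n by (auto simp: f_def dist_real_def eq(1))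
  qed simp
  show ?thesis
    using left right unfolding f_def[symmetric] has_field_derivative_iff
    by (auto intro: filterlim_split_at simp: at_within_Ici_at_right at_within_Iic_at_left)
qed

section \<open>One-dimensional interpolating splines\<close>

definition shift_diff :: "(int \<Rightarrow> real) \<Rightarrow> int \<Rightarrow> real" where
  "shift_diff g n = g (n + 1) - g n"

definition newton_poly :: "nat \<Rightarrow> real poly" where
  "newton_poly a = smult (1 / fact a) (\<Prod>j<a. [:- real j, 1:])"

lemma poly_newton_poly: "poly (newton_poly a) x = x gchoose a"
  by (simp add: newton_poly_def poly_prod gbinomial_prod_rev atLeast0LessThan)

lemma degree_newton_poly: "degree (newton_poly a) \<le> a"
proof -
  have "degree (\<Prod>j<a. [:- real j, 1:]) \<le> (\<Sum>j<a. degree [:- real j, 1:])"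
    using degree_prod_sum_le[of "{..<a}" "\<lambda>j. [:- real j, 1:]"] by (simp add: o_def)
  then show ?thesis
    by (simp add: newton_poly_def)
qed

lemma newton_poly_0 [simp]: "newton_poly 0 = 1"
  by (simp add: newton_poly_def)

lemma newton_poly_shift:
  "pcompose (newton_poly (Suc a)) [:1, 1:] = newton_poly a + newton_poly (Suc a)"
  by (simp add: poly_eq_poly_eq_iff[symmetric] fun_eq_iff poly_pcompose poly_newton_poly
      add.commute[of 1] gbinomial_Suc_Suc)

text \<open>
  The polynomial \<open>\<theta>\<close>. It vanishes at 0 to order \<open>k + 1\<close> since \<open>1 - (1 - y) ^ Suc k\<close> is divisible by
  \<open>y\<close>, and \<open>1 - \<theta>\<close> is a power of \<open>1 - X ^ Suc k\<close>,
  which is divisible by \<open>1 - X\<close>, so that it vanishes at 1 to order \<open>k + 1\<close>.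
\<close>

definition step_poly :: "nat \<Rightarrow> real poly" where
  "step_poly k = 1 - (1 - [:0, 1:] ^ Suc k) ^ Suc k"

lemma step_poly_at_0: "[:0, 1:] ^ Suc k dvd step_poly k"
proof -
  have "(1 - (1 - [:0, 1:] ^ Suc k)) dvd (1 ^ Suc k - (1 - [:0, 1 :: real:] ^ Suc k) ^ Suc k)"
    unfolding power_diff_sumr2[of 1 "Suc k"] by (rule dvd_triv_left)
  then show ?thesis
    by (simp add: step_poly_def del: power_Suc)
qed

lemma step_poly_at_1: "[:0, 1:] ^ Suc k dvd pcompose (step_poly k) [:1, 1:] - 1"
proof -
  have "[:1, 1 :: real:] - 1 dvd [:1, 1:] ^ Suc k - 1 ^ Suc k"
    unfolding power_diff_sumr2[of _ "Suc k" 1] by (rule dvd_triv_left)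
  moreover have "[:1, 1 :: real:] - 1 = [:0, 1:]"
    by (simp add: one_pCons)
  ultimately have "[:0, 1 :: real:] dvd [:1, 1:] ^ Suc k - 1"
    by (simp del: power_Suc)
  then have "[:0, 1 :: real:] dvd 1 - [:1, 1:] ^ Suc k"
    by (metis dvd_minus_iff minus_diff_eq)
  then have "[:0, 1 :: real:] ^ Suc k dvd (1 - [:1, 1:] ^ Suc k) ^ Suc k"
    by (rule dvd_power_same)
  moreover have "pcompose (step_poly k) [:1, 1:] - 1 = - ((1 - [:1, 1:] ^ Suc k) ^ Suc k)"
    by (simp add: poly_eq_poly_eq_iff[symmetric] fun_eq_iff poly_pcompose step_poly_def del: power_Suc)
  ultimately show ?thesis
    by (simp del: power_Suc)
qed

text \<open>
  The coefficient of the \<open>a\<close>-th difference at \<open>n\<close> in \<open>(1 - \<theta>) P n + \<theta> P (n + 1)\<close>, in the variable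
  \<open>X = t - n\<close>: the Newton basis up to \<open>k - 1\<close>, and \<open>\<theta>\<close> times the coefficient of the \<open>k\<close>-th
  difference in \<open>P (n + 1) - P n\<close> for \<open>a = k\<close>.
\<close>

definition cell_basis :: "nat \<Rightarrow> nat \<Rightarrow> real poly" where
  "cell_basis k a =
     (if a < k then newton_poly a else pcompose (newton_poly (k - 1)) [:-1, 1:] * step_poly k)"

definition cell_poly :: "nat \<Rightarrow> (int \<Rightarrow> real) \<Rightarrow> int \<Rightarrow> real poly" where
  "cell_poly k g n = (\<Sum>a\<le>k. smult ((shift_diff ^^ a) g n) (cell_basis k a))"

lemma shift_diff_funpow_add:
  "(shift_diff ^^ a) g (n + 1) = (shift_diff ^^ a) g n + (shift_diff ^^ Suc a) g n"
  by (simp add: shift_diff_def)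

text \<open>
  Moving the base point of Newton interpolation by one step changes the interpolating polynomial of
  degree at most \<open>r\<close> only by the next difference. The left-hand side is \<open>P (n + 1) - P n\<close>, written in
  the coordinate centred at \<open>n + 1\<close>.
\<close>

lemma newton_poly_change_base:
  "(\<Sum>a\<le>r. smult ((shift_diff ^^ a) g (n + 1)) (newton_poly a))
   - (\<Sum>a\<le>r. smult ((shift_diff ^^ a) g n) (pcompose (newton_poly a) [:1, 1:]))
   = smult ((shift_diff ^^ Suc r) g n) (newton_poly r)"
proof (induction r)
  case 0
  show ?case by (simp add: pcompose_1 shift_diff_def smult_diff_left[symmetric])
next
  case (Suc r)
  then show ?case
    unfolding sum.atMost_Suc newton_poly_shift shift_diff_funpow_add[of "Suc r"]
      smult_add_left smult_add_right
    by (simp only: algebra_simps)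
qed

text \<open>
  At the common end point \<open>n + 1\<close> of two neighbouring cells, both pieces agree with \<open>P (n + 1)\<close> to
  order \<open>k\<close>: the left one because \<open>\<theta>\<close> is flat at 1, the right one because \<open>\<theta>\<close> is flat at 0. So
  their difference, centred at \<open>n + 1\<close>, is divisible by \<open>X ^ Suc k\<close>.
\<close>

lemma cell_poly_jets_match:
  assumes "k \<ge> 1" "b \<le> k"
  shows "poly ((pderiv ^^ b) (cell_poly k g n)) 1 = poly ((pderiv ^^ b) (cell_poly k g (n + 1))) 0"
proof -
  obtain r where k: "k = Suc r"
    using \<open>k \<ge> 1\<close> by (cases k) auto
  have split: "cell_poly k g n = (\<Sum>a\<le>r. smult ((shift_diff ^^ a) g n) (newton_poly a))
      + smult ((shift_diff ^^ k) g n) (pcompose (newton_poly r) [:-1, 1:] * step_poly k)" for n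
    unfolding cell_poly_def k sum.atMost_Suc by (auto simp: cell_basis_def intro!: sum.cong)
  have unshift: "pcompose (pcompose (newton_poly r) [:-1, 1:]) [:1, 1:] = newton_poly r"
    by (simp add: poly_eq_poly_eq_iff[symmetric] fun_eq_iff poly_pcompose)
  have "pcompose (cell_poly k g n) [:1, 1:] - cell_poly k g (n + 1)
      = smult ((shift_diff ^^ k) g n) (newton_poly r * (pcompose (step_poly k) [:1, 1:] - 1))
        - smult ((shift_diff ^^ k) g (n + 1)) (pcompose (newton_poly r) [:-1, 1:] * step_poly k)"
    using newton_poly_change_base[where g = g and n = n and r = r]
    unfolding split pcompose_add pcompose_smult pcompose_sum pcompose_mult unshift k[symmetric]
    by (simp add: algebra_simps smult_diff_right del: funpow.simps)
  also have "[:0, 1:] ^ Suc k dvd \<dots>"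
    by (rule dvd_diff[OF dvd_smult[OF dvd_mult[OF step_poly_at_1]]
          dvd_smult[OF dvd_mult[OF step_poly_at_0]]])
  finally have "poly ((pderiv ^^ b) (pcompose (cell_poly k g n) [:1, 1:] - cell_poly k g (n + 1))) 0 = 0"
    by (rule higher_pderiv_root) fact
  moreover have "(pderiv ^^ b) (p - q) = (pderiv ^^ b) p - (pderiv ^^ b) q" for p q :: "real poly"
    by (induction b arbitrary: p q) (simp_all add: pderiv_diff)
  ultimately show ?thesis
    by (simp add: higher_pderiv_shift poly_pcompose)
qed

text \<open>
  The \<open>b\<close>-th derivative of the spline. At integers it is read off from the piece on the right, which
  is legitimate for \<open>b \<le> k\<close> by the matching of jets.
\<close>

definition spline :: "nat \<Rightarrow> nat \<Rightarrow> (int \<Rightarrow> real) \<Rightarrow> real \<Rightarrow> real" where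
  "spline k b g t = poly ((pderiv ^^ b) (cell_poly k g \<lfloor>t\<rfloor>)) (frac t)"

lemma spline_has_derivative:
  assumes "k \<ge> 1" "b < k"
  shows "(spline k b g has_real_derivative spline k (Suc b) g t) (at t)"
  using has_derivative_floor_glued_polys[of "\<lambda>n. (pderiv ^^ b) (cell_poly k g n)" t]
    cell_poly_jets_match[OF \<open>k \<ge> 1\<close>, of b] cell_poly_jets_match[OF \<open>k \<ge> 1\<close>, of "Suc b"] \<open>b < k\<close>
  unfolding spline_def[abs_def] by simp

lemma spline_interpolates:
  assumes "k \<ge> 1"
  shows "spline k 0 g (of_int n) = g n"
proof -
  have "poly (cell_basis k a) 0 = (if a = 0 then 1 else 0)" for a
  proof -
    have "poly (step_poly k) 0 = 0"
      using higher_pderiv_root[OF step_poly_at_0, of 0 k] by simp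
    then show ?thesis
      using \<open>k \<ge> 1\<close> by (simp add: cell_basis_def poly_newton_poly gbinomial_0_left)
  qed
  then show ?thesis
    by (simp add: spline_def cell_poly_def poly_sum if_distrib[of "(*) _"] sum.delta cong: if_cong)
qed

text \<open>
  Here \<open>a < k\<close>, so the polynomial has degree \<open>a < b\<close>. Hence the \<open>b\<close>-th derivative of the spline does
  not see the differences of order less than \<open>b\<close>.
\<close>

lemma higher_pderiv_cell_basis:
  assumes "a < b" "b \<le> k"
  shows "(pderiv ^^ b) (cell_basis k a) = 0"
proof -
  obtain c where b: "b = Suc (a + c)"
    using \<open>a < b\<close> less_iff_Suc_add by auto
  have "degree ((pderiv ^^ (a + c)) (newton_poly a)) = 0"
    using degree_newton_poly[of a] by (simp add: degree_higher_pderiv)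
  then show ?thesis
    using assms by (simp add: b cell_basis_def pderiv_eq_0_iff)
qed

lemma shift_diff_funpow_expand:
  "\<exists>c. \<forall>g n. (shift_diff ^^ r) g n = (\<Sum>j\<le>r. c j * g (n + int j))"
proof (induction r)
  case 0
  show ?case by (rule exI[of _ "\<lambda>_. 1"]) simp
next
  case (Suc r)
  then obtain c where c: "\<And>g n. (shift_diff ^^ r) g n = (\<Sum>j\<le>r. c j * g (n + int j))"
    by blast
  define c' where "c' j = (if j = 0 then 0 else c (j - 1)) - (if j \<le> r then c j else 0)" for j
  have "(shift_diff ^^ Suc r) g n = (\<Sum>j\<le>Suc r. c' j * g (n + int j))" for g n
  proof -
    have "(\<Sum>j\<le>Suc r. (if j = 0 then 0 else c (j - 1)) * g (n + int j))
        = (\<Sum>j\<le>r. c j * g (n + 1 + int j))"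
      by (simp add: sum.atMost_Suc_shift add_ac del: sum.atMost_Suc)
    moreover have "(\<Sum>j\<le>Suc r. (if j \<le> r then c j else 0) * g (n + int j))
        = (\<Sum>j\<le>r. c j * g (n + int j))"
      by simp
    ultimately show ?thesis
      by (simp add: c'_def left_diff_distrib sum_subtractf shift_diff_def c del: sum.atMost_Suc)
  qed
  then show ?case by blast
qed

lemma poly_bounded_on_unit_interval:
  fixes p :: "real poly"
  shows "\<exists>W. \<forall>s\<in>{0..1}. \<bar>poly p s\<bar> \<le> W"
proof -
  have "compact (poly p ` {0..1})"
    by (intro compact_continuous_image continuous_intros compact_Icc)
  then show ?thesis
    by (auto dest!: compact_imp_bounded simp: bounded_iff simp del: atLeastAtMost_iff)
qed

text \<open>
  Each surviving difference has order \<open>a \<ge> b\<close> and is therefore a combination, with fixed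
  coefficients, of \<open>b\<close>-th differences at the points \<open>n, \<dots>, n + k\<close>. The weights depend on \<open>k\<close> only,
  not on the data, which makes the final constant independent of \<open>m\<close> and \<open>f\<close>.
\<close>

lemma spline_local_combination:
  obtains w :: "nat \<Rightarrow> nat \<Rightarrow> real poly" and W :: real where
    "\<And>b g t. b \<le> k \<Longrightarrow>
       spline k b g t = (\<Sum>j\<le>k. poly (w b j) (frac t) * (shift_diff ^^ b) g (\<lfloor>t\<rfloor> + int j))"
    "\<And>b j t. b \<le> k \<Longrightarrow> j \<le> k \<Longrightarrow> \<bar>poly (w b j) (frac t)\<bar> \<le> W"
    "W \<ge> 1"
proof -
  obtain c where c: "\<And>r g n. (shift_diff ^^ r) g n = (\<Sum>j\<le>r. c r j * g (n + int j))"
    using shift_diff_funpow_expand by metis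
  define w where "w b j = (\<Sum>a\<in>{b..k}. smult (if j \<le> a - b then c (a - b) j else 0)
      ((pderiv ^^ b) (cell_basis k a)))" for b j
  have w: "spline k b g t = (\<Sum>j\<le>k. poly (w b j) (frac t) * (shift_diff ^^ b) g (\<lfloor>t\<rfloor> + int j))"
    if "b \<le> k" for b g t
  proof -
    have diff: "(shift_diff ^^ a) g n
        = (\<Sum>j\<le>k. (if j \<le> a - b then c (a - b) j else 0) * (shift_diff ^^ b) g (n + int j))"
      if "a \<in> {b..k}" for a n
    proof -
      have "(shift_diff ^^ a) g n = (shift_diff ^^ (a - b)) ((shift_diff ^^ b) g) n"
        using that by (simp flip: funpow_add[THEN fun_cong, unfolded o_apply])
      also have "\<dots> = (\<Sum>j\<le>a - b. c (a - b) j * (shift_diff ^^ b) g (n + int j))"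
        by (rule c)
      also have "\<dots> = (\<Sum>j\<le>k. (if j \<le> a - b then c (a - b) j else 0) * (shift_diff ^^ b) g (n + int j))"
        using that by (intro sum.mono_neutral_cong_left) auto
      finally show ?thesis .
    qed
    have "spline k b g t
        = (\<Sum>a\<le>k. (shift_diff ^^ a) g \<lfloor>t\<rfloor> * poly ((pderiv ^^ b) (cell_basis k a)) (frac t))"
      by (simp add: spline_def cell_poly_def higher_pderiv_sum higher_pderiv_smult poly_sum)
    also have "\<dots> = (\<Sum>a\<in>{b..k}. (shift_diff ^^ a) g \<lfloor>t\<rfloor> * poly ((pderiv ^^ b) (cell_basis k a)) (frac t))"
      using \<open>b \<le> k\<close> by (intro sum.mono_neutral_right) (auto simp: higher_pderiv_cell_basis)
    also have "\<dots> = (\<Sum>a\<in>{b..k}. \<Sum>j\<le>k. (if j \<le> a - b then c (a - b) j else 0)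
        * (shift_diff ^^ b) g (\<lfloor>t\<rfloor> + int j) * poly ((pderiv ^^ b) (cell_basis k a)) (frac t))"
      by (intro sum.cong refl) (subst diff, simp_all add: sum_distrib_right)
    also have "\<dots> = (\<Sum>j\<le>k. poly (w b j) (frac t) * (shift_diff ^^ b) g (\<lfloor>t\<rfloor> + int j))"
      by (subst sum.swap) (auto simp: w_def poly_sum sum_distrib_right intro!: sum.cong)
    finally show ?thesis .
  qed
  have "\<forall>b j. \<exists>V. \<forall>s\<in>{0..1}. \<bar>poly (w b j) s\<bar> \<le> V"
    using poly_bounded_on_unit_interval by blast
  then obtain V where V: "\<And>b j s. s \<in> {0..1} \<Longrightarrow> \<bar>poly (w b j) s\<bar> \<le> V b j"
    unfolding choice_iff by blast
  define W where "W = 1 + (\<Sum>b\<le>k. \<Sum>j\<le>k. \<bar>V b j\<bar>)"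
  have "\<bar>poly (w b j) (frac t)\<bar> \<le> W" if "b \<le> k" "j \<le> k" for b j t
  proof -
    have "\<bar>V b j\<bar> \<le> (\<Sum>j\<le>k. \<bar>V b j\<bar>)"
      using that by (intro member_le_sum) auto
    also have "\<dots> \<le> (\<Sum>b\<le>k. \<Sum>j\<le>k. \<bar>V b j\<bar>)"
      using that by (intro member_le_sum[of b "{..k}" "\<lambda>b. \<Sum>j\<le>k. \<bar>V b j\<bar>"]) (auto intro: sum_nonneg)
    finally show ?thesis
      using V[of "frac t" b j] by (simp add: W_def frac_lt_1 less_imp_le)
  qed
  moreover have "W \<ge> 1"
    by (simp add: W_def sum_nonneg)
  ultimately show thesis
    using w that by blast
qed

lemma shift_diff_funpow_translate:
  "(shift_diff ^^ a) (\<lambda>p. g (p + z)) n = (shift_diff ^^ a) g (n + z)"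
  by (induction a arbitrary: n) (simp_all add: shift_diff_def add_ac)

lemma spline_translate: "spline k b g (t + of_int z) = spline k b (\<lambda>p. g (p + z)) t"
proof -
  have "cell_poly k g (n + z) = cell_poly k (\<lambda>p. g (p + z)) n" for n
    by (simp add: cell_poly_def shift_diff_funpow_translate)
  then show ?thesis
    by (simp add: spline_def frac_def)
qed

section \<open>Iterated derivatives from partial derivatives\<close>

text \<open>
  The value at \<open>(u\<^sub>1, \<dots>, u\<^sub>n)\<close> of the multilinear form whose value at the coordinate vectors
  \<open>(e i\<^sub>1, \<dots>, e i\<^sub>n)\<close> is \<open>g [i\<^sub>1, \<dots>, i\<^sub>n]\<close>.
\<close>

fun word_sum :: "(real^'d) list \<Rightarrow> ('d::finite list \<Rightarrow> real) \<Rightarrow> real" where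
  "word_sum [] g = g []"
| "word_sum (u # us) g = (\<Sum>i\<in>UNIV. u $ i * word_sum us (\<lambda>is. g (i # is)))"

lemma word_sum_diff: "word_sum us (\<lambda>is. g is - h is) = word_sum us g - word_sum us h"
  by (induction us arbitrary: g h) (simp_all add: right_diff_distrib sum_subtractf)

lemma word_sum_linear:
  "word_sum us (\<lambda>is. \<Sum>j\<in>UNIV. c j * g j is) = (\<Sum>j\<in>UNIV. c j * word_sum us (g j))"
proof (induction us arbitrary: g)
  case (Cons u us)
  show ?case
    by (simp add: Cons.IH sum_distrib_left mult.left_commute) (rule sum.swap)
qed simp

text \<open>
  With the sum-norm, the norm of a multilinear form is controlled by its largest coefficient without
  any loss depending on the dimension.
\<close>

lemma word_sum_bound:
  assumes "\<And>is. length is = length us \<Longrightarrow> \<bar>g is\<bar> \<le> C"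
  shows "\<bar>word_sum us g\<bar> \<le> tuple_norm us * C"
  using assms
proof (induction us arbitrary: g)
  case Nil
  then show ?case by (simp add: tuple_norm_def)
next
  case (Cons u us)
  have "\<bar>word_sum (u # us) g\<bar> \<le> (\<Sum>i\<in>UNIV. \<bar>u $ i\<bar> * \<bar>word_sum us (\<lambda>is. g (i # is))\<bar>)"
    by (auto simp: abs_mult[symmetric] intro!: sum_abs)
  also have "\<dots> \<le> (\<Sum>i\<in>UNIV. \<bar>u $ i\<bar> * (tuple_norm us * C))"
    by (intro sum_mono mult_left_mono Cons.IH Cons.prems) auto
  also have "\<dots> = tuple_norm (u # us) * C"
    by (simp add: tuple_norm_def sum_norm_def sum_distrib_right mult.assoc)
  finally show ?case .
qed

lemma word_sum_has_derivative:
  assumes "\<And>is. length is = length us \<Longrightarrow> (G is has_derivative G' is) (at x)"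
  shows "((\<lambda>y. word_sum us (\<lambda>is. G is y)) has_derivative (\<lambda>v. word_sum us (\<lambda>is. G' is v))) (at x)"
  using assms
proof (induction us arbitrary: G G')
  case (Cons u us)
  show ?case
    unfolding word_sum.simps
    by (intro has_derivative_sum has_derivative_mult_right Cons.IH Cons.prems) simp
qed simp

text \<open>
  \<open>G [i\<^sub>1, \<dots>, i\<^sub>n]\<close> plays the part of the partial derivative of \<open>G []\<close> in the directions
  \<open>i\<^sub>1, \<dots>, i\<^sub>n\<close>. Requiring total differentiability with the next partials as coefficients for words
  shorter than \<open>k\<close> gives derivatives up to order \<open>k\<close>; those of order \<open>k\<close> need not be
  continuous, which suffices for a Lipschitz bound in order \<open>k - 1\<close>.
\<close>

locale partial_derivative_family =
  fixes G :: "'d::finite list \<Rightarrow> real^'d \<Rightarrow> real" and k :: nat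
  assumes partials: "length is < k \<Longrightarrow>
    (G is has_derivative (\<lambda>v. \<Sum>i\<in>UNIV. v $ i * G (i # is) x)) (at x)"
begin

lemma word_sum_partials:
  assumes "length us < k"
  shows "((\<lambda>y. word_sum us (\<lambda>is. G is y)) has_derivative
           (\<lambda>v. word_sum (v # us) (\<lambda>is. G is x))) (at x)"
proof -
  have "((\<lambda>y. word_sum us (\<lambda>is. G is y)) has_derivative
      (\<lambda>v. word_sum us (\<lambda>is. \<Sum>i\<in>UNIV. v $ i * G (i # is) x))) (at x)"
    by (intro word_sum_has_derivative partials) (use assms in simp)
  then show ?thesis
    by (simp add: word_sum_linear)
qed

lemma iter_deriv_eq_word_sum:
  assumes "length us \<le> k"
  shows "iter_deriv (G []) x us = word_sum us (\<lambda>is. G is x)"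
  using assms
proof (induction us arbitrary: x)
  case (Cons u us)
  have "(\<lambda>y. iter_deriv (G []) y us) = (\<lambda>y. word_sum us (\<lambda>is. G is y))"
    using Cons by simp
  moreover have "length us < k"
    using Cons.prems by simp
  ultimately show ?case
    using frechet_derivative_at[OF word_sum_partials[of us x], symmetric] by simp
qed simp

lemma iter_deriv_differentiable:
  assumes "length us < k"
  shows "(\<lambda>y. iter_deriv (G []) y us) differentiable (at x)"
  using word_sum_partials[OF assms] assms
  by (auto simp: differentiable_def iter_deriv_eq_word_sum[OF less_imp_le])

lemma class_C_pred:
  assumes "k \<ge> 1"
  shows "class_C (k - 1) (G [])"
  using assms iter_deriv_differentiable unfolding class_C_def
  by (auto intro!: continuous_at_imp_continuous_on differentiable_imp_continuous_within)

text \<open>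
  The mean value theorem on the segment from \<open>y\<close> to \<open>x\<close>.
\<close>

lemma Lipschitz_top_partials:
  assumes "length is < k" and bound: "\<And>i y. \<bar>G (i # is) y\<bar> \<le> B"
  shows "\<bar>G is x - G is y\<bar> \<le> B * sum_norm (x - y)"
proof -
  define h where "h = (\<lambda>t. G is (y + t *\<^sub>R (x - y)))"
  have h: "(h has_real_derivative (\<Sum>i\<in>UNIV. (x - y) $ i * G (i # is) (y + t *\<^sub>R (x - y)))) (at t)" for t
  proof -
    have "((\<lambda>t. y + t *\<^sub>R (x - y)) has_derivative (\<lambda>s. s *\<^sub>R (x - y))) (at t)"
      by (auto intro!: derivative_eq_intros)
    from has_derivative_compose[OF this partials[OF assms(1)]]
    have "(h has_derivative
        (\<lambda>s. \<Sum>i\<in>UNIV. (s *\<^sub>R (x - y)) $ i * G (i # is) (y + t *\<^sub>R (x - y)))) (at t)"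
      by (simp add: h_def)
    also have "(\<lambda>s. \<Sum>i\<in>UNIV. (s *\<^sub>R (x - y)) $ i * G (i # is) (y + t *\<^sub>R (x - y)))
        = (*) (\<Sum>i\<in>UNIV. (x - y) $ i * G (i # is) (y + t *\<^sub>R (x - y)))"
      by (simp add: fun_eq_iff sum_distrib_left mult_ac)
    finally show ?thesis
      by (rule has_field_derivative_def[THEN iffD2])
  qed
  obtain t where t: "h 1 - h 0 = (1 - 0) * (\<Sum>i\<in>UNIV. (x - y) $ i * G (i # is) (y + t *\<^sub>R (x - y)))"
    using MVT2[of 0 1 h, OF _ h] by auto
  have "\<bar>G is x - G is y\<bar> = \<bar>\<Sum>i\<in>UNIV. (x - y) $ i * G (i # is) (y + t *\<^sub>R (x - y))\<bar>"
    using t by (simp add: h_def)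
  also have "\<dots> \<le> (\<Sum>i\<in>UNIV. \<bar>(x - y) $ i\<bar> * B)"
    by (rule order_trans[OF sum_abs])
       (auto simp: abs_mult intro!: sum_mono mult_left_mono bound)
  finally show ?thesis
    by (simp add: sum_norm_def sum_distrib_left mult.commute)
qed

lemma Lip_iter_deriv:
  assumes "k \<ge> 1" and bound: "\<And>is x. length is = k \<Longrightarrow> \<bar>G is x\<bar> \<le> B"
  shows "Lip (k - 1) (iter_deriv (G [])) \<le> ennreal B"
  unfolding Lip_def
proof (rule Inf_lower, rule CollectI, intro allI)
  fix x y :: "real^'d"
  have norm_ge: "sum_norm v \<ge> 0" for v :: "real^'d"
    by (simp add: sum_norm_def sum_nonneg)
  have tuple_ge: "tuple_norm us \<ge> 0" for us :: "(real^'d) list"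
    by (induction us) (simp_all add: tuple_norm_def norm_ge)
  have "B \<ge> 0"
    using bound[of "replicate k undefined"] abs_ge_zero order_trans by (metis length_replicate)
  have "\<bar>iter_deriv (G []) x us - iter_deriv (G []) y us\<bar> / tuple_norm us \<le> B * sum_norm (x - y)"
    if us: "length us = k - 1" for us
  proof -
    have "\<bar>iter_deriv (G []) x us - iter_deriv (G []) y us\<bar>
        = \<bar>word_sum us (\<lambda>is. G is x - G is y)\<bar>"
      using us by (simp add: iter_deriv_eq_word_sum word_sum_diff)
    also have "\<dots> \<le> tuple_norm us * (B * sum_norm (x - y))"
      using us \<open>k \<ge> 1\<close> by (intro word_sum_bound Lipschitz_top_partials bound) auto
    finally show ?thesis
      using tuple_ge[of us] norm_ge[of "x - y"] \<open>B \<ge> 0\<close>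
      by (cases "tuple_norm us = 0") (simp_all add: divide_le_eq mult.commute)
  qed
  then show "form_norm (k - 1) (\<lambda>us. iter_deriv (G []) x us - iter_deriv (G []) y us)
      \<le> ennreal B * ennreal (sum_norm (x - y))"
    unfolding form_norm_def using \<open>B \<ge> 0\<close> norm_ge[of "x - y"]
    by (auto simp: ennreal_mult[symmetric] intro!: SUP_least ennreal_leI)
qed

end

section \<open>The tensor product spline\<close>

definition lattice_point :: "nat^'d \<Rightarrow> ('d \<Rightarrow> int) \<Rightarrow> real^'d" where
  "lattice_point m p = (\<chi> i. of_int (p i) / real (m $ i))"

lemma lattice_point_in_refined_lattice: "lattice_point m p \<in> refined_lattice m"
  by (auto simp: lattice_point_def refined_lattice_def)

definition residue_box :: "nat^'d \<Rightarrow> ('d \<Rightarrow> int) set" where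
  "residue_box m = PiE UNIV (\<lambda>i. {0..<int (m $ i)})"

definition residue_indicator :: "nat \<Rightarrow> int \<Rightarrow> int \<Rightarrow> real" where
  "residue_indicator m r p = of_bool (p mod int m = r)"

text \<open>
  For words of length at most \<open>k\<close>, the partial derivative along the word \<open>is\<close> of the interpolating
  function, which is the case \<open>is = []\<close>. Each factor depends on a single coordinate, so differentiating along \<open>is\<close> means
  differentiating the \<open>i\<close>-th factor once for each occurrence of \<open>i\<close> in \<open>is\<close>.
\<close>

definition tensor_spline ::
  "nat \<Rightarrow> nat^'d \<Rightarrow> (real^'d \<Rightarrow> real) \<Rightarrow> 'd::finite list \<Rightarrow> real^'d \<Rightarrow> real" where
  "tensor_spline k m f is x = (\<Sum>\<nu>\<in>residue_box m. f (lattice_point m \<nu>) *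
     (\<Prod>i\<in>UNIV. real (m $ i) ^ count_list is i *
        spline k (count_list is i) (residue_indicator (m $ i) (\<nu> i)) (real (m $ i) * x $ i)))"

lemma finite_residue_box: "finite (residue_box (m :: nat^'d::finite))"
  unfolding residue_box_def by (intro finite_PiE) auto

lemma tensor_spline_partials:
  assumes "k \<ge> 1"
  shows "partial_derivative_family (tensor_spline k m f) k"
proof
  fix "is" :: "'a list" and x :: "real^'a"
  assume "length is < k"
  then have count: "count_list is i < k" for i
    using count_le_length[of "is" i] by simp
  define h where "h js \<nu> i t = real (m $ i) ^ count_list js i *
      spline k (count_list js i) (residue_indicator (m $ i) (\<nu> i)) (real (m $ i) * t)" for js \<nu> i t
  have same: "h (j # is) \<nu> i = h is \<nu> i" if "i \<noteq> j" for i j \<nu>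
    using that by (auto simp: h_def)
  have deriv: "((\<lambda>x. h is \<nu> i (x $ i)) has_derivative (\<lambda>v. v $ i * h (i # is) \<nu> i (x $ i))) (at x)" for i \<nu>
  proof -
    have "(h is \<nu> i has_real_derivative h (i # is) \<nu> i t) (at t)" for t
      unfolding h_def
      by (rule derivative_eq_intros DERIV_chain2[OF spline_has_derivative[OF assms count]] refl)+ simp
    then have *: "(h is \<nu> i has_derivative (\<lambda>s. h (i # is) \<nu> i (x $ i) * s)) (at (x $ i))"
      by (simp add: has_field_derivative_def)
    have "((\<lambda>x. x $ i) has_derivative (\<lambda>v. v $ i)) (at x)"
      by (rule bounded_linear_imp_has_derivative[OF bounded_linear_vec_nth])
    from has_derivative_compose[OF this *] show ?thesis
      by (simp add: mult.commute)
  qed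
  have "((\<lambda>x. \<Prod>i\<in>UNIV. h is \<nu> i (x $ i)) has_derivative
      (\<lambda>v. \<Sum>j\<in>UNIV. v $ j * (\<Prod>i\<in>UNIV. h (j # is) \<nu> i (x $ i)))) (at x)" for \<nu>
  proof -
    have "(\<Prod>i\<in>UNIV. h (j # is) \<nu> i (x $ i))
        = h (j # is) \<nu> j (x $ j) * (\<Prod>i\<in>UNIV - {j}. h is \<nu> i (x $ i))" for j
      by (subst prod.remove[of _ j]) (auto simp: same intro!: prod.cong)
    then show ?thesis
      using has_derivative_prod[of UNIV "\<lambda>i x. h is \<nu> i (x $ i)", OF deriv]
      by (simp add: mult.assoc)
  qed
  from has_derivative_sum[OF has_derivative_mult_right[OF this]]
  have "(tensor_spline k m f is has_derivative
      (\<lambda>v. \<Sum>\<nu>\<in>residue_box m. f (lattice_point m \<nu>) *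
        (\<Sum>j\<in>UNIV. v $ j * (\<Prod>i\<in>UNIV. h (j # is) \<nu> i (x $ i))))) (at x)"
    unfolding tensor_spline_def[abs_def] h_def .
  also have "(\<lambda>v. \<Sum>\<nu>\<in>residue_box m. f (lattice_point m \<nu>) *
        (\<Sum>j\<in>UNIV. v $ j * (\<Prod>i\<in>UNIV. h (j # is) \<nu> i (x $ i))))
      = (\<lambda>v. \<Sum>i\<in>UNIV. v $ i * tensor_spline k m f (i # is) x)"
    unfolding tensor_spline_def h_def sum_distrib_left mult.left_commute[of _ "_ $ _"]
    by (intro ext sum.swap)
  finally show "(tensor_spline k m f is has_derivative
      (\<lambda>v. \<Sum>i\<in>UNIV. v $ i * tensor_spline k m f (i # is) x)) (at x)" .
qed

text \<open>
  The product of the indicators singles out the representative of \<open>p\<close> in the fundamental box, and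
  periodicity of \<open>f\<close> moves it back to \<open>p\<close>.
\<close>

lemma sum_residue_box_indicator:
  fixes m :: "nat^'d::finite"
  assumes m: "\<forall>i. m $ i > 0" and f: "periodic_on (refined_lattice m) f"
  shows "(\<Sum>\<nu>\<in>residue_box m. f (lattice_point m \<nu>) *
      (\<Prod>i\<in>UNIV. residue_indicator (m $ i) (\<nu> i) (p i))) = f (lattice_point m p)"
proof -
  define r where "r = (\<lambda>i. p i mod int (m $ i))"
  have r: "r \<in> residue_box m"
    using m by (auto simp: residue_box_def r_def)
  have "(\<Prod>i\<in>UNIV. residue_indicator (m $ i) (\<nu> i) (p i)) = (if \<nu> = r then 1 else 0)" for \<nu>
  proof (cases "\<nu> = r")
    case False
    then obtain i where "r i \<noteq> \<nu> i" by (metis ext)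
    then show ?thesis
      using False by (auto simp: residue_indicator_def r_def intro!: prod_zero)
  qed (simp add: residue_indicator_def r_def)
  then have "(\<Sum>\<nu>\<in>residue_box m. f (lattice_point m \<nu>) *
      (\<Prod>i\<in>UNIV. residue_indicator (m $ i) (\<nu> i) (p i))) = f (lattice_point m r)"
    using r by (simp add: finite_residue_box if_distrib[of "(*) _"] cong: if_cong)
  also have "\<dots> = f (lattice_point m p)"
  proof -
    define z :: "real^'d" where "z = (\<chi> i. of_int (p i div int (m $ i)))"
    have "lattice_point m p = lattice_point m r + z"
    proof (simp add: vec_eq_iff lattice_point_def z_def, intro allI)
      fix i
      have "real_of_int (p i) = of_int (r i) + of_int (p i div int (m $ i)) * real (m $ i)"
        unfolding r_def using mod_div_mult_eq[of "p i" "int (m $ i)"]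
        by (metis of_int_add of_int_mult of_int_of_nat_eq)
      then show "real_of_int (p i) / real (m $ i)
          = of_int (r i) / real (m $ i) + of_int (p i div int (m $ i))"
        using m by (simp add: field_simps)
    qed
    moreover have "z \<in> integer_lattice"
      by (simp add: z_def integer_lattice_def)
    ultimately show ?thesis
      using f by (simp add: periodic_on_def lattice_point_in_refined_lattice)
  qed
  finally show ?thesis .
qed

text \<open>
  Differences of the indicators along the coordinates pass to differences of \<open>f\<close> along the lattice
  generators. This links the one-dimensional splines with the seminorm.
\<close>

lemma sum_residue_box_shift_diff:
  fixes m :: "nat^'d::finite"
  assumes m: "\<forall>i. m $ i > 0" and f: "periodic_on (refined_lattice m) f"
  shows "(\<Sum>\<nu>\<in>residue_box m. f (lattice_point m \<nu>) *
      (\<Prod>i\<in>UNIV. (shift_diff ^^ count_list is i) (residue_indicator (m $ i) (\<nu> i)) (p i)))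
    = iter_diff (map (\<lambda>i. axis i (1 / real (m $ i))) is) f (lattice_point m p)"
proof (induction "is" arbitrary: p)
  case Nil
  show ?case
    using sum_residue_box_indicator[OF assms] by (simp add: iter_diff_def)
next
  case (Cons j js)
  define D where "D is \<nu> p = (\<Prod>i\<in>UNIV. (shift_diff ^^ count_list is i)
      (residue_indicator (m $ i) (\<nu> i)) (p i))" for "is" \<nu> p
  have D: "D (j # js) \<nu> p = D js \<nu> (p(j := p j + 1)) - D js \<nu> p" for \<nu>
    unfolding D_def prod.remove[OF finite UNIV_I[of j]]
    by (auto simp: shift_diff_def left_diff_distrib intro!: arg_cong2[of _ _ _ _ "(-)"] prod.cong)
  have "lattice_point m (p(j := p j + 1)) = lattice_point m p + axis j (1 / real (m $ j))"
    by (simp add: vec_eq_iff lattice_point_def axis_def add_divide_distrib)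
  then show ?case
    using Cons.IH[of "p(j := p j + 1)"] Cons.IH[of p]
    unfolding D_def[symmetric] D right_diff_distrib sum_subtractf
    by (simp add: iter_diff_def forward_diff_def del: fun_upd_apply)
qed

lemma tensor_spline_interpolates:
  fixes m :: "nat^'d::finite"
  assumes "k \<ge> 1" and m: "\<forall>i. m $ i > 0" and f: "periodic_on (refined_lattice m) f"
    and "x \<in> refined_lattice m"
  shows "tensor_spline k m f [] x = f x"
proof -
  obtain p where p: "\<And>i. x $ i = of_int (p i) / real (m $ i)"
    using \<open>x \<in> refined_lattice m\<close> by (auto simp: refined_lattice_def choice_iff)
  then have "x = lattice_point m p"
    by (simp add: vec_eq_iff lattice_point_def)
  moreover have "real (m $ i) * x $ i = of_int (p i)" for i
    using m by (simp add: p)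
  ultimately show ?thesis
    using sum_residue_box_indicator[OF m f, of p]
    by (simp add: tensor_spline_def spline_interpolates[OF \<open>k \<ge> 1\<close>])
qed

lemma tensor_spline_periodic: "periodic_on UNIV (tensor_spline k m f [])"
  unfolding periodic_on_def
proof (intro ballI)
  fix x z :: "real^'a" assume "z \<in> integer_lattice"
  then have "\<forall>i. \<exists>y::int. z $ i = of_int y"
    by (auto simp: integer_lattice_def Ints_def)
  then obtain y :: "'a \<Rightarrow> int" where y: "\<And>i. z $ i = of_int (y i)"
    by (auto simp: choice_iff)
  have "real (m $ i) * (x + z) $ i = real (m $ i) * x $ i + of_int (int (m $ i) * y i)" for i
    by (simp add: y distrib_left)
  moreover have "residue_indicator n r (p + int n * q) = residue_indicator n r p" for n r p q
    by (simp add: residue_indicator_def)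
  ultimately show "tensor_spline k m f [] (x + z) = tensor_spline k m f [] x"
    by (simp add: tensor_spline_def spline_translate del: of_int_mult)
qed

lemma prod_power_count_list:
  fixes c :: "'a::finite \<Rightarrow> real"
  shows "(\<Prod>i\<in>UNIV. c i ^ count_list is i) = prod_list (map c is)"
proof (induction "is")
  case (Cons j js)
  have "(\<Prod>i\<in>UNIV. c i ^ count_list (j # js) i)
      = (\<Prod>i\<in>UNIV. (if i = j then c j else 1) * c i ^ count_list js i)"
    by (intro prod.cong) auto
  then show ?case
    using Cons by (simp add: prod.distrib)
qed simp

text \<open>
  Expanding the product of the local combinations in all coordinates gives a sum over the offsets
  \<open>J\<close> in \<open>{0..k} ^ d\<close> of bounded weights times differences of \<open>f\<close> of order \<open>k\<close>. The product \<open>M\<close> of the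
  scaling factors is cancelled by the product \<open>T\<close> of the lengths of the lattice generators.
\<close>

lemma tensor_spline_bound:
  fixes k :: nat
  obtains A :: real where "A > 0"
    "\<And>(m :: nat^'d::finite) f N is x.
       \<forall>i. m $ i > 0 \<Longrightarrow> periodic_on (refined_lattice m) f \<Longrightarrow> length is = k \<Longrightarrow>
       (\<And>p. \<bar>iter_diff (map (\<lambda>i. axis i (1 / real (m $ i))) is) f (lattice_point m p)\<bar>
          \<le> N * tuple_norm (map (\<lambda>i. axis i (1 / real (m $ i))) is)) \<Longrightarrow>
       \<bar>tensor_spline k m f is x\<bar> \<le> A * N"
proof -
  obtain w :: "nat \<Rightarrow> nat \<Rightarrow> real poly" and W :: real where
    w: "\<And>b g t. b \<le> k \<Longrightarrow>
       spline k b g t = (\<Sum>j\<le>k. poly (w b j) (frac t) * (shift_diff ^^ b) g (\<lfloor>t\<rfloor> + int j))"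
    and W: "\<And>b j t. b \<le> k \<Longrightarrow> j \<le> k \<Longrightarrow> \<bar>poly (w b j) (frac t)\<bar> \<le> W"
    and "W \<ge> 1"
    using spline_local_combination by blast
  define Js where "Js = PiE (UNIV :: 'd set) (\<lambda>_. {..k})"
  define A where "A = real (card Js) * W ^ CARD('d)"
  have Js: "finite Js" "(\<lambda>_. 0) \<in> Js"
    by (auto simp: Js_def intro!: finite_PiE)
  then have "card Js > 0"
    by (auto simp: card_gt_0_iff)
  then have "A > 0"
    using \<open>W \<ge> 1\<close> by (simp add: A_def)
  moreover have "\<bar>tensor_spline k m f is x\<bar> \<le> A * N"
    if m: "\<forall>i. m $ i > 0" and f: "periodic_on (refined_lattice m) f" and len: "length is = k"
      and N: "\<And>p. \<bar>iter_diff (map (\<lambda>i. axis i (1 / real (m $ i))) is) f (lattice_point m p)\<bar>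
          \<le> N * tuple_norm (map (\<lambda>i. axis i (1 / real (m $ i))) is)"
    for m :: "nat^'d" and f N "is" x
  proof -
    define T where "T = tuple_norm (map (\<lambda>i. axis i (1 / real (m $ i))) is)"
    define M where "M = (\<Prod>i\<in>UNIV. real (m $ i) ^ count_list is i)"
    have "M \<ge> 0" by (simp add: M_def prod_nonneg)
    have MT: "M * T = 1"
    proof -
      have "sum_norm (axis i c) = \<bar>c\<bar>" for i :: 'd and c
      proof -
        have "sum_norm (axis i c) = (\<Sum>j\<in>UNIV. if j = i then \<bar>c\<bar> else 0)"
          unfolding sum_norm_def by (intro sum.cong) (auto simp: axis_def)
        then show ?thesis by simp
      qed
      then have "T = prod_list (map (\<lambda>i. 1 / real (m $ i)) is)"
        by (simp add: T_def tuple_norm_def o_def)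
      moreover have "prod_list (map (\<lambda>i. real (m $ i)) is) * prod_list (map (\<lambda>i. 1 / real (m $ i)) is) = 1"
        using m by (induction "is") (simp_all add: field_simps)
      ultimately show ?thesis
        by (simp add: M_def prod_power_count_list)
    qed
    define c where "c = count_list is"
    have c: "c i \<le> k" for i
      using count_le_length[of "is" i] len by (simp add: c_def)
    define t where "t i = real (m $ i) * x $ i" for i
    define P where "P J = (\<Prod>i\<in>UNIV. poly (w (c i) (J i)) (frac (t i)))" for J
    define d where "d J = iter_diff (map (\<lambda>i. axis i (1 / real (m $ i))) is) f
        (lattice_point m (\<lambda>i. \<lfloor>t i\<rfloor> + int (J i)))" for J
    define D where "D J \<nu> = (\<Prod>i\<in>UNIV. (shift_diff ^^ c i)
        (residue_indicator (m $ i) (\<nu> i)) (\<lfloor>t i\<rfloor> + int (J i)))" for J \<nu>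
    have "(\<Prod>i\<in>UNIV. real (m $ i) ^ c i * spline k (c i) (residue_indicator (m $ i) (\<nu> i)) (t i))
        = M * (\<Sum>J\<in>Js. P J * D J \<nu>)" for \<nu>
    proof -
      have "(\<Prod>i\<in>UNIV. spline k (c i) (residue_indicator (m $ i) (\<nu> i)) (t i))
          = (\<Sum>J\<in>Js. P J * D J \<nu>)"
        unfolding w[OF c] Js_def P_def D_def prod.distrib[symmetric]
        by (rule prod_sum_PiE) auto
      then show ?thesis
        by (simp add: prod.distrib M_def c_def)
    qed
    then have "tensor_spline k m f is x
        = (\<Sum>\<nu>\<in>residue_box m. f (lattice_point m \<nu>) * (M * (\<Sum>J\<in>Js. P J * D J \<nu>)))"
      by (simp add: tensor_spline_def c_def t_def)
    also have "\<dots> = (\<Sum>\<nu>\<in>residue_box m. \<Sum>J\<in>Js. M * P J * (f (lattice_point m \<nu>) * D J \<nu>))"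
      by (simp add: sum_distrib_left mult_ac)
    also have "\<dots> = (\<Sum>J\<in>Js. M * P J * (\<Sum>\<nu>\<in>residue_box m. f (lattice_point m \<nu>) * D J \<nu>))"
      by (subst sum.swap) (simp add: sum_distrib_left)
    also have "\<dots> = (\<Sum>J\<in>Js. M * P J * d J)"
      unfolding D_def c_def sum_residue_box_shift_diff[OF m f] d_def ..
    finally have "\<bar>tensor_spline k m f is x\<bar> \<le> (\<Sum>J\<in>Js. \<bar>M * P J * d J\<bar>)"
      by (metis sum_abs)
    also have "\<dots> \<le> (\<Sum>J\<in>Js. M * W ^ CARD('d) * (N * T))"
    proof (intro sum_mono)
      fix J assume "J \<in> Js"
      then have "\<bar>P J\<bar> \<le> W ^ CARD('d)"
        unfolding P_def abs_prod Js_def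
        using prod_mono[of UNIV "\<lambda>i. \<bar>poly (w (c i) (J i)) (frac (t i))\<bar>" "\<lambda>_. W"] W[OF c]
        by auto
      moreover have "\<bar>d J\<bar> \<le> N * T"
        unfolding d_def T_def by (rule N)
      ultimately show "\<bar>M * P J * d J\<bar> \<le> M * W ^ CARD('d) * (N * T)"
        using \<open>M \<ge> 0\<close> \<open>W \<ge> 1\<close> by (auto simp: abs_mult intro!: mult_mono)
    qed
    also have "\<dots> = A * N * (M * T)"
      by (simp add: A_def)
    finally show ?thesis
      by (simp add: MT)
  qed
  ultimately show thesis
    using that by blast
qed

lemma iter_diff_le_diff_seminorm:
  assumes "diff_seminorm k m f = ennreal N" "N \<ge> 0"
    and "length us = k" "set us \<subseteq> refined_lattice m - {0}" "x \<in> refined_lattice m"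
  shows "\<bar>iter_diff us f x\<bar> \<le> N * tuple_norm us"
proof -
  have "tuple_norm us > 0"
    using assms(4)
  proof (induction us)
    case (Cons u us)
    have "sum_norm u > 0"
    proof -
      obtain i where "u $ i \<noteq> 0"
        using Cons.prems by (auto simp: vec_eq_iff)
      then show ?thesis
        unfolding sum_norm_def by (intro sum_pos2[of _ i]) auto
    qed
    then show ?case
      using Cons by (simp add: tuple_norm_def)
  qed (simp add: tuple_norm_def)
  have "ennreal (\<bar>iter_diff us f x\<bar> / tuple_norm us) \<le> diff_seminorm k m f"
    unfolding diff_seminorm_def using assms(3-5)
    by (intro SUP_upper2[of us] SUP_upper2[of x]) auto
  then have "\<bar>iter_diff us f x\<bar> / tuple_norm us \<le> N"
    using assms(1,2) by simp
  then show ?thesis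
    using \<open>tuple_norm us > 0\<close> by (simp add: divide_le_eq)
qed

section \<open>The interpolation theorem\<close>

theorem theoremA:
  fixes k l :: nat
  assumes "k \<ge> 1" and "l \<ge> 1"
  shows "\<exists>A::real. A > 0 \<and>
    (\<forall>(m::nat^'d::finite) (f::real^'d \<Rightarrow> real).
       (\<forall>i. m $ i > 0) \<longrightarrow>
       (\<forall>i j. real (m $ i) / real (m $ j) \<le> real l) \<longrightarrow>
       periodic_on (refined_lattice m) f \<longrightarrow>
       (\<exists>F::real^'d \<Rightarrow> real.
          periodic_on UNIV F \<and> class_C (k - 1) F \<and>
          (\<forall>x\<in>refined_lattice m. F x = f x) \<and>
          Lip (k - 1) (iter_deriv F) \<le> ennreal A * diff_seminorm k m f))"
proof -
  obtain A :: real where "A > 0" and A: "\<And>(m :: nat^'d) f N is x.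
       \<forall>i. m $ i > 0 \<Longrightarrow> periodic_on (refined_lattice m) f \<Longrightarrow> length is = k \<Longrightarrow>
       (\<And>p. \<bar>iter_diff (map (\<lambda>i. axis i (1 / real (m $ i))) is) f (lattice_point m p)\<bar>
          \<le> N * tuple_norm (map (\<lambda>i. axis i (1 / real (m $ i))) is)) \<Longrightarrow>
       \<bar>tensor_spline k m f is x\<bar> \<le> A * N"
    using tensor_spline_bound by blast
  show ?thesis
  proof (rule exI[of _ A], intro conjI allI impI \<open>A > 0\<close>)
    fix m :: "nat^'d" and f :: "real^'d \<Rightarrow> real"
    assume m: "\<forall>i. m $ i > 0" and f: "periodic_on (refined_lattice m) f"
    interpret partial_derivative_family "tensor_spline k m f" k
      by (rule tensor_spline_partials) fact
    have "Lip (k - 1) (iter_deriv (tensor_spline k m f [])) \<le> ennreal A * diff_seminorm k m f"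
    proof (cases "diff_seminorm k m f")
      case (real N)
      have "\<bar>tensor_spline k m f is x\<bar> \<le> A * N" if "length is = k" for "is" x
      proof (rule A[OF m f that])
        fix p
        have "axis i (1 / real (m $ i)) \<in> refined_lattice m - {0}" for i
        proof -
          have "axis i (1 / real (m $ i)) $ j
              = of_int (if j = i then 1 else 0) / real (m $ j)" for j
            by (simp add: axis_def)
          moreover have "axis i (1 / real (m $ i)) \<noteq> 0"
            using m by (simp add: axis_eq_0_iff less_imp_neq[symmetric])
          ultimately show ?thesis
            unfolding refined_lattice_def by blast
        qed
        then have "set (map (\<lambda>i. axis i (1 / real (m $ i))) is) \<subseteq> refined_lattice m - {0}"
          by (simp only: set_map image_subset_iff) blast
        then show "\<bar>iter_diff (map (\<lambda>i. axis i (1 / real (m $ i))) is) f (lattice_point m p)\<bar>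
            \<le> N * tuple_norm (map (\<lambda>i. axis i (1 / real (m $ i))) is)"
          using real that
          by (intro iter_diff_le_diff_seminorm[of k m]) (auto simp: lattice_point_in_refined_lattice)
      qed
      from Lip_iter_deriv[OF \<open>k \<ge> 1\<close> this] show ?thesis
        using real \<open>A > 0\<close> by (simp add: ennreal_mult)
    next
      case top
      then show ?thesis
        using \<open>A > 0\<close> by (simp add: ennreal_mult_top)
    qed
    then show "\<exists>F. periodic_on UNIV F \<and> class_C (k - 1) F \<and>
          (\<forall>x\<in>refined_lattice m. F x = f x) \<and>
          Lip (k - 1) (iter_deriv F) \<le> ennreal A * diff_seminorm k m f"
      using tensor_spline_periodic class_C_pred[OF \<open>k \<ge> 1\<close>]
        tensor_spline_interpolates[OF \<open>k \<ge> 1\<close> m f] by blast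
  qed
qed


end
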